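(* Consider the two problems described in the context, and assume that the algorithms solving them achieve exact convergence. Suppose $\underline\varepsilon\le1$. Then the solution of the KKT-based problem is included in the solution set of the bi-level problem obtained by the gradient-descent algorithm. That is, if $(Q_1,R_1)$ (with some $\kappa$) solves $$\min_{Q,R,\kappa}\ \kappa^2\quad\text{s.t.}\quad(K_f^T\mathcal{Q}K_f+\mathcal{R})\tilde u+K_f^T\mathcal{Q}^TK_pz_{\mathrm{ini}}=0,\quad I\preceq\operatorname{diag}(Q,R)\preceq\kappa I,$$ then $\theta_1=\operatorname{col}(\operatorname{vech}(Q_1),\operatorname{vech}(R_1))$ belongs to the set $\mathcal{I}_2$ of solutions of the gradient-descent algorithm for the bi-level problem.
   Context: Data: Let $\tilde u\in\mathbb{R}^{mN}$ be the stacked noise-free optimal inputs (last $N$ samples of the observed optimal trajectory), $z_{\mathrm{ini}}=\operatorname{col}(u^{\mathrm{ini}},y^{\mathrm{ini}})\in\mathbb{R}^{(m+p)T_{\mathrm{ini}}}$ the stacked first $T_{\mathrm{ini}}$ inputs and outputs of that trajectory, and $(K_p\mid K_f)=Y_f\operatorname{col}(U_p,Y_p,U_f)^\dagger$. Here $\operatorname{col}(U_p,U_f)$ and $\operatorname{col}(Y_p,Y_f)$ are the Hankel matrices with $T_{\mathrm{ini}}+N$ block rows of the inputs and outputs of an offline trajectory of an LTI system with $m$ inputs and $p$ outputs, split into the first $T_{\mathrm{ini}}$ and last $N$ block rows; $K_f$ has $mN$ columns. For symmetric $Q\in\mathbb{S}^p$, $R\in\mathbb{S}^m$: $\mathcal{Q}=\operatorname{diag}(Q,\dots,Q)$,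 $\mathcal{R}=\operatorname{diag}(R,\dots,R)$ ($N$ blocks each). The data are noiseless, and the problem is identifiable (the positive definite solutions $(Q,R)$ of the linear equation $(K_f^T\mathcal{Q}K_f+\mathcal{R})\tilde u+K_f^T\mathcal{Q}^TK_pz_{\mathrm{ini}}=0$ are exactly the positive multiples of the true weights). Bi-level problem: for $\theta=\operatorname{col}(\operatorname{vech}(Q),\operatorname{vech}(R))$ let $$J(u;\theta)=z_{\mathrm{ini}}^TK_p^T\mathcal{Q}K_pz_{\mathrm{ini}}+2z_{\mathrm{ini}}^TK_p^T\mathcal{Q}K_fu+u^T(K_f^T\mathcal{Q}K_f+\mathcal{R})u,$$ $u^*_\theta=\arg\min_uJ(u;\theta)$, and $\mathcal{S}(\theta)=\|\tilde u-u^*_\theta\|_2^2$. The problem is to minimize $\mathcal{S}$ over $\mathcal{D}=\{\theta:\underline\varepsilon I\preceq Q,R\preceq\bar\varepsilon I\}$, $0<\underline\varepsilon<\bar\varepsilon<\infty$, with $\bar\varepsilon$ taken large enough that the upper bound does not exclude the solution $\theta_1$. Solution set $\mathcal{I}_2$: the gradient-descent algorithm returns points $\theta^*\in\mathcal{D}$ (with matrices $Q^*,R^*$) that satisfy the optimality conditions $$(\tilde u-u^*_{\theta^*})^T(K_f^T\mathcal{Q}^*K_f+\mathcal{R}^* )^{-1}\tilde\Phi(u^*_{\theta^*})=0\ \ (\text{i.e. }\nabla\mathcal{S}(\theta^* )=0)\qquad\text{and}\qquad\nabla^2\mathcal{S}(\theta^* )\succ0 ,$$ and $\mathcal{I}_2$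 is the set of such points. Here, for $u=\operatorname{col}(u_0,\dots,u_{N-1})$, $\tilde\Phi(u)$ is the matrix with $\tilde\Phi(u)\operatorname{col}(\operatorname{vech}(Q),\operatorname{vech}(R))=(K_f^T\mathcal{Q}K_f+\mathcal{R})u+K_f^T\mathcal{Q}^TK_pz_{\mathrm{ini}}$ for all symmetric $Q,R$.
   Formalization: Since S(cθ)=S(θ) for c>0, ∇²S(θ* )≻0 never holds on D, so the set I₂ as printed is empty; the formal statement instead requires v^T∇²S(θ* )v>0 only for all v that are not multiples of θ*. *)

theory Defs
  imports "HOL-Analysis.Analysis"
begin

subsection \<open>Matrices\<close>

type_synonym 'a rvec = "(real, 'a) vec"

text \<open>Real matrices, rows indexed by the first argument and columns by the second.\<close>

type_synonym ('a, 'b) rmat = "((real, 'b) vec, 'a) vec"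

definition posdef :: "('a::finite, 'a) rmat \<Rightarrow> bool" where
  "posdef M \<longleftrightarrow> transpose M = M \<and> (\<forall>x. x \<noteq> 0 \<longrightarrow> 0 < x \<bullet> (M *v x))"

definition possemidef :: "('a::finite, 'a) rmat \<Rightarrow> bool" where
  "possemidef M \<longleftrightarrow> transpose M = M \<and> (\<forall>x. 0 \<le> x \<bullet> (M *v x))"

definition loewner_le :: "('a::finite, 'a) rmat \<Rightarrow> ('a, 'a) rmat \<Rightarrow> bool" (infix \<open>\<preceq>\<close> 50) where
  "A \<preceq> B \<longleftrightarrow> possemidef (B - A)"

text \<open>The Moore--Penrose inverse: the unique solution of the four Penrose equations.\<close>

definition pinv :: "('b::finite, 'a::finite) rmat \<Rightarrow> ('a, 'b) rmat" where
  "pinv A = (THE X. A ** X ** A = A \<and> X ** A ** X = X \<and>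
     transpose (A ** X) = A ** X \<and> transpose (X ** A) = X ** A)"

text \<open>\<open>col x y\<close> stacks two vectors, or two matrices (whose rows are the entries of type
  \<open>'e\<close>); \<open>row_blocks A B\<close> is the matrix (A | B).\<close>

definition col :: "'e^'a \<Rightarrow> 'e^'b \<Rightarrow> 'e^('a + 'b)" where
  "col x y = (\<chi> k. case k of Inl a \<Rightarrow> x $ a | Inr b \<Rightarrow> y $ b)"

definition row_blocks :: "'e^'a^'c \<Rightarrow> 'e^'b^'c \<Rightarrow> 'e^('a + 'b)^'c" where
  "row_blocks A B = (\<chi> i. col (A $ i) (B $ i))"

definition diag2 :: "('a::finite, 'a) rmat \<Rightarrow> ('b::finite, 'b) rmat \<Rightarrow> ('a + 'b, 'a + 'b) rmat" where
  "diag2 A B = col (row_blocks A 0) (row_blocks 0 B)"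

text \<open>diag(Q,\<dots>,Q) with CARD('n) blocks; index \<open>(k, i)\<close> is entry \<open>i\<close> of block \<open>k\<close>.\<close>

definition blkdiag :: "('a::finite, 'a) rmat \<Rightarrow> ('n::finite \<times> 'a, 'n \<times> 'a) rmat" where
  "blkdiag Q = (\<chi> r c. if fst r = fst c then Q $ snd r $ snd c else 0)"

subsection \<open>Half-vectorization\<close>

typedef (overloaded) ('a::linorder) tri = "{(i::'a, j). j \<le> i}"
  by auto

instance tri :: ("{finite, linorder}") finite
proof
  have "(UNIV :: 'a tri set) = Abs_tri ` {(i, j). j \<le> i}"
    by (metis type_definition.Abs_image type_definition_tri)
  then show "finite (UNIV :: 'a tri set)"
    by (metis finite finite_imageI)
qed

definition vech :: "('a::{finite,linorder}, 'a) rmat \<Rightarrow> 'a tri rvec" where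
  "vech Q = (\<chi> k. case Rep_tri k of (i, j) \<Rightarrow> Q $ i $ j)"

definition unvech :: "'a::{finite,linorder} tri rvec \<Rightarrow> ('a, 'a) rmat" where
  "unvech v = (\<chi> i j. v $ Abs_tri (max i j, min i j))"

lemma transpose_unvech: "transpose (unvech v) = unvech v"
  by (simp add: transpose_def unvech_def vec_eq_iff max.commute min.commute)

lemma unvech_vech: "transpose Q = Q \<Longrightarrow> unvech (vech Q) = Q"
  by (auto simp: vech_def unvech_def vec_eq_iff transpose_def Abs_tri_inverse max_def min_def)

lemma vech_unvech: "vech (unvech v) = v"
proof -
  have "Abs_tri (max i j, min i j) = k" if "Rep_tri k = (i, j)" for k :: "'a tri" and i j
  proof -
    have "j \<le> i" using Rep_tri[of k] that by simp
    then show ?thesis using that by (metis Rep_tri_inverse max.absorb1 min.absorb2)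
  qed
  then show ?thesis
    by (auto simp: vech_def unvech_def vec_eq_iff split: prod.split)
qed

type_synonym ('p, 'm) theta = "('p tri + 'm tri) rvec"

text \<open>The weights \<open>Q\<close>, \<open>R\<close> encoded by \<open>\<theta>\<close> = col(vech(Q), vech(R)).\<close>

definition Q_of :: "('p::{finite,linorder}, 'm::{finite,linorder}) theta \<Rightarrow> ('p, 'p) rmat"
  where "Q_of \<theta> = unvech (\<chi> k. \<theta> $ Inl k)"

definition R_of :: "('p::{finite,linorder}, 'm::{finite,linorder}) theta \<Rightarrow> ('m, 'm) rmat"
  where "R_of \<theta> = unvech (\<chi> k. \<theta> $ Inr k)"

lemma Q_of_col: "transpose Q = Q \<Longrightarrow> Q_of (col (vech Q) v) = Q"
  and R_of_col: "transpose R = R \<Longrightarrow> R_of (col w (vech R)) = R"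
  by (simp_all add: Q_of_def R_of_def col_def unvech_vech)

subsection \<open>Trajectories and Hankel matrices\<close>

text \<open>Positions along a time axis are indexed by a finite linearly ordered type;
  \<open>rank\<close> numbers them 0, 1, 2, \<dots>.\<close>

definition rank :: "'k::{finite,linorder} \<Rightarrow> nat" where
  "rank k = card {j. j < k}"

definition lti_trajectory ::
  "('s::finite, 's) rmat \<Rightarrow> ('s, 'm::finite) rmat \<Rightarrow> ('p::finite, 's) rmat \<Rightarrow> ('p, 'm) rmat \<Rightarrow> nat \<Rightarrow>
   (nat \<Rightarrow> 'm rvec) \<Rightarrow> (nat \<Rightarrow> 'p rvec) \<Rightarrow> bool" where
  "lti_trajectory A B C D L u y \<longleftrightarrow>
     (\<exists>x. \<forall>k<L. x (Suc k) = A *v x k + B *v u k \<and> y k = C *v x k + D *v u k)"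

text \<open>The samples of \<open>w\<close> at times \<open>s\<close>, \<dots>, \<open>s + CARD('k) - 1\<close>, stacked.\<close>

definition stack :: "nat \<Rightarrow> (nat \<Rightarrow> 'a::finite rvec) \<Rightarrow> ('k::{finite,linorder} \<times> 'a) rvec" where
  "stack s w = (\<chi> r. w (s + rank (fst r)) $ snd r)"

text \<open>Block rows \<open>s\<close>, \<dots>, \<open>s + CARD('k) - 1\<close> of the Hankel matrix of \<open>w\<close> with CARD('l) columns.\<close>

definition hankel ::
  "nat \<Rightarrow> (nat \<Rightarrow> 'a::finite rvec) \<Rightarrow> ('k::{finite,linorder} \<times> 'a, 'l::{finite,linorder}) rmat" where
  "hankel s w = (\<chi> r c. w (s + rank (fst r) + rank c) $ snd r)"

subsection \<open>Cost, stationarity equation and the KKT-based problem\<close>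

definition Hmat ::
  "('n::finite \<times> 'p::finite, 'n \<times> 'm::finite) rmat \<Rightarrow> ('p, 'p) rmat \<Rightarrow> ('m, 'm) rmat \<Rightarrow> ('n \<times> 'm, 'n \<times> 'm) rmat" where
  "Hmat Kf Q R = transpose Kf ** blkdiag Q ** Kf + blkdiag R"

definition cost ::
  "('n::finite \<times> 'p::finite, 'z::finite) rmat \<Rightarrow> ('n \<times> 'p, 'n \<times> 'm::finite) rmat \<Rightarrow> 'z rvec \<Rightarrow>
   ('p, 'p) rmat \<Rightarrow> ('m, 'm) rmat \<Rightarrow> ('n \<times> 'm) rvec \<Rightarrow> real" where
  "cost Kp Kf z Q R u =
     z \<bullet> ((transpose Kp ** blkdiag Q ** Kp) *v z)
     + 2 * (z \<bullet> ((transpose Kp ** blkdiag Q ** Kf) *v u))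
     + u \<bullet> (Hmat Kf Q R *v u)"

definition stat ::
  "('n::finite \<times> 'p::finite, 'z::finite) rmat \<Rightarrow> ('n \<times> 'p, 'n \<times> 'm::finite) rmat \<Rightarrow> 'z rvec \<Rightarrow>
   ('p, 'p) rmat \<Rightarrow> ('m, 'm) rmat \<Rightarrow> ('n \<times> 'm) rvec \<Rightarrow> ('n \<times> 'm) rvec" where
  "stat Kp Kf z Q R u =
     Hmat Kf Q R *v u + (transpose Kf ** transpose (blkdiag Q) ** Kp) *v z"

definition kkt_feasible ::
  "('n::finite \<times> 'p::finite, 'z::finite) rmat \<Rightarrow> ('n \<times> 'p, 'n \<times> 'm::finite) rmat \<Rightarrow> 'z rvec \<Rightarrow> ('n \<times> 'm) rvec \<Rightarrow>
   ('p, 'p) rmat \<Rightarrow> ('m, 'm) rmat \<Rightarrow> real \<Rightarrow> bool" where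
  "kkt_feasible Kp Kf z ut Q R \<kappa> \<longleftrightarrow>
     transpose Q = Q \<and> transpose R = R \<and> stat Kp Kf z Q R ut = 0 \<and>
     mat 1 \<preceq> diag2 Q R \<and> diag2 Q R \<preceq> mat \<kappa>"

definition kkt_solution ::
  "('n::finite \<times> 'p::finite, 'z::finite) rmat \<Rightarrow> ('n \<times> 'p, 'n \<times> 'm::finite) rmat \<Rightarrow> 'z rvec \<Rightarrow> ('n \<times> 'm) rvec \<Rightarrow>
   ('p, 'p) rmat \<Rightarrow> ('m, 'm) rmat \<Rightarrow> real \<Rightarrow> bool" where
  "kkt_solution Kp Kf z ut Q R \<kappa> \<longleftrightarrow>
     kkt_feasible Kp Kf z ut Q R \<kappa> \<and>
     (\<forall>Q' R' \<kappa>'. kkt_feasible Kp Kf z ut Q' R' \<kappa>' \<longrightarrow> \<kappa>\<^sup>2 \<le> \<kappa>'\<^sup>2)"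

definition identifiable ::
  "('n::finite \<times> 'p::finite, 'z::finite) rmat \<Rightarrow> ('n \<times> 'p, 'n \<times> 'm::finite) rmat \<Rightarrow> 'z rvec \<Rightarrow> ('n \<times> 'm) rvec \<Rightarrow>
   ('p, 'p) rmat \<Rightarrow> ('m, 'm) rmat \<Rightarrow> bool" where
  "identifiable Kp Kf z ut Q\<^sub>0 R\<^sub>0 \<longleftrightarrow>
     (\<forall>Q R. posdef Q \<and> posdef R \<and> stat Kp Kf z Q R ut = 0 \<longleftrightarrow>
            (\<exists>c>0. Q = c *\<^sub>R Q\<^sub>0 \<and> R = c *\<^sub>R R\<^sub>0))"

subsection \<open>The bi-level problem\<close>

definition u_star ::
  "('n::finite \<times> 'p::{finite,linorder}, 'z::finite) rmat \<Rightarrow> ('n \<times> 'p, 'n \<times> 'm::{finite,linorder}) rmat \<Rightarrow> 'z rvec \<Rightarrow>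
   ('p, 'm) theta \<Rightarrow> ('n \<times> 'm) rvec" where
  "u_star Kp Kf z \<theta> = (ARG_MIN (cost Kp Kf z (Q_of \<theta>) (R_of \<theta>)) u. True)"

definition S_obj ::
  "('n::finite \<times> 'p::{finite,linorder}, 'z::finite) rmat \<Rightarrow> ('n \<times> 'p, 'n \<times> 'm::{finite,linorder}) rmat \<Rightarrow> 'z rvec \<Rightarrow> ('n \<times> 'm) rvec \<Rightarrow>
   ('p, 'm) theta \<Rightarrow> real" where
  "S_obj Kp Kf z ut \<theta> = (norm (ut - u_star Kp Kf z \<theta>))\<^sup>2"

definition Dset :: "real \<Rightarrow> real \<Rightarrow>
   (('p::{finite,linorder}, 'm::{finite,linorder}) theta) set" where
  "Dset \<epsilon>l \<epsilon>u = {\<theta>. mat \<epsilon>l \<preceq> Q_of \<theta> \<and> Q_of \<theta> \<preceq> mat \<epsilon>u \<and> mat \<epsilon>l \<preceq> R_of \<theta> \<and> R_of \<theta> \<preceq> mat \<epsilon>u}"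

definition Phi ::
  "('n::finite \<times> 'p::{finite,linorder}, 'z::finite) rmat \<Rightarrow> ('n \<times> 'p, 'n \<times> 'm::{finite,linorder}) rmat \<Rightarrow> 'z rvec \<Rightarrow> ('n \<times> 'm) rvec \<Rightarrow>
   ('n \<times> 'm, 'p tri + 'm tri) rmat" where
  "Phi Kp Kf z u = matrix (\<lambda>\<theta>. stat Kp Kf z (Q_of \<theta>) (R_of \<theta>) u)"

lemma Q_of_add: "Q_of (a + b) = Q_of a + Q_of b"
  and R_of_add: "R_of (a + b) = R_of a + R_of b"
  and Q_of_scaleR: "Q_of (c *\<^sub>R a) = c *\<^sub>R Q_of a"
  and R_of_scaleR: "R_of (c *\<^sub>R a) = c *\<^sub>R R_of a"
  by (simp_all add: Q_of_def R_of_def unvech_def vec_eq_iff)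

lemma blkdiag_add: "blkdiag (A + B) = blkdiag A + blkdiag B"
  and blkdiag_scaleR: "blkdiag (c *\<^sub>R A) = c *\<^sub>R blkdiag A"
  by (simp_all add: blkdiag_def vec_eq_iff)

lemma transpose_add': "transpose (A + B) = transpose A + transpose (B :: real^'a^'b)"
  and transpose_scaleR': "transpose (c *\<^sub>R B) = c *\<^sub>R transpose B"
  by (simp_all add: transpose_def vec_eq_iff)

lemma matrix_mul_scaleR_left: "(c *\<^sub>R A) ** (B :: real^'a^'b) = c *\<^sub>R (A ** B)"
  and matrix_mul_scaleR_right: "A ** (c *\<^sub>R (B :: real^'a^'b)) = c *\<^sub>R (A ** B)"
  by (simp_all add: matrix_matrix_mult_def vec_eq_iff sum_distrib_left mult_ac)

lemma matrix_add_rdistrib': "(A + B) ** (M :: real^'a^'b) = A ** M + B ** M"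
  by (simp add: matrix_matrix_mult_def vec_eq_iff sum.distrib distrib_right)

lemma stat_add: "stat Kp Kf z (Q + Q') (R + R') u = stat Kp Kf z Q R u + stat Kp Kf z Q' R' u"
  by (simp add: stat_def Hmat_def blkdiag_add transpose_add' matrix_add_ldistrib
      matrix_add_rdistrib' matrix_vector_mult_add_rdistrib)

lemma stat_scaleR: "stat Kp Kf z (c *\<^sub>R Q) (c *\<^sub>R R) u = c *\<^sub>R stat Kp Kf z Q R u"
  by (simp add: stat_def Hmat_def blkdiag_scaleR transpose_scaleR' matrix_mul_scaleR_left
      matrix_mul_scaleR_right scaleR_matrix_vector_assoc [symmetric] matrix_vector_mult_add_rdistrib
      scaleR_add_right)

lemma Phi_col_vech:
  assumes "transpose Q = Q" "transpose R = R"
  shows "Phi Kp Kf z u *v col (vech Q) (vech R) = stat Kp Kf z Q R u"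
proof -
  have "linear (\<lambda>\<theta>. stat Kp Kf z (Q_of \<theta>) (R_of \<theta>) u)"
    by (rule linearI) (simp_all add: Q_of_add R_of_add Q_of_scaleR R_of_scaleR stat_add stat_scaleR)
  then have "Phi Kp Kf z u *v \<theta> = stat Kp Kf z (Q_of \<theta>) (R_of \<theta>) u" for \<theta>
    by (simp add: Phi_def matrix_works)
  then show ?thesis
    using assms by (simp add: Q_of_col R_of_col)
qed

text \<open>\<open>H\<close> is the Hessian of \<open>f\<close> at \<open>x\<close>: the derivative at \<open>x\<close> of a gradient field that exists
  near \<open>x\<close>.\<close>

definition has_hessian :: "('a::finite rvec \<Rightarrow> real) \<Rightarrow> ('a, 'a) rmat \<Rightarrow> 'a rvec \<Rightarrow> bool" where
  "has_hessian f H x \<longleftrightarrow>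
     (\<exists>g. (\<forall>\<^sub>F y in nhds x. GDERIV f y :> g y) \<and> (g has_derivative (\<lambda>h. H *v h)) (at x))"

lemma cost_scaleR: "cost Kp Kf z (c *\<^sub>R Q) (c *\<^sub>R R) u = c * cost Kp Kf z Q R u"
  by (simp add: cost_def Hmat_def blkdiag_scaleR matrix_mul_scaleR_left
      matrix_mul_scaleR_right scaleR_matrix_vector_assoc [symmetric] matrix_vector_mult_add_rdistrib
      inner_add_right algebra_simps)

lemma S_obj_scaleR:
  assumes "c > 0"
  shows "S_obj Kp Kf z ut (c *\<^sub>R \<theta>) = S_obj Kp Kf z ut \<theta>"
proof -
  have "cost Kp Kf z (Q_of (c *\<^sub>R \<theta>)) (R_of (c *\<^sub>R \<theta>)) = (\<lambda>u. c * cost Kp Kf z (Q_of \<theta>) (R_of \<theta>) u)"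
    by (simp add: fun_eq_iff Q_of_scaleR R_of_scaleR cost_scaleR)
  then have "u_star Kp Kf z (c *\<^sub>R \<theta>) = u_star Kp Kf z \<theta>"
    using assms by (simp add: u_star_def arg_min_def is_arg_min_def)
  then show ?thesis by (simp add: S_obj_def)
qed

text \<open>The objective depends on \<open>\<theta>\<close> only up to a positive factor, so its Hessian is degenerate
  along \<open>\<theta>\<close> itself: it is not positive definite at any nonzero point.\<close>

lemma S_obj_hessian_ray:
  assumes "has_hessian (S_obj Kp Kf z ut) H \<theta>"
  shows "\<theta> \<bullet> (H *v \<theta>) = 0"
proof -
  let ?S = "S_obj Kp Kf z ut" and ?r = "\<lambda>t::real. (1 + t) *\<^sub>R \<theta>"
  obtain g where g: "\<forall>\<^sub>F y in nhds \<theta>. GDERIV ?S y :> g y"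
    and g': "(g has_derivative (\<lambda>h. H *v h)) (at \<theta>)"
    using assms by (auto simp: has_hessian_def)
  have r: "(?r has_derivative (\<lambda>s. s *\<^sub>R \<theta>)) (at t)" for t
    by (auto intro!: derivative_eq_intros)
  have zero: "\<theta> \<bullet> g (?r t) = 0" if gt: "GDERIV ?S (?r t) :> g (?r t)" and t: "t > -1" for t
  proof -
    have "((\<lambda>t. ?S (?r t)) has_derivative (\<lambda>s. (s *\<^sub>R \<theta>) \<bullet> g (?r t))) (at t)"
      using has_derivative_compose[OF r[of t], of ?S "\<lambda>h. h \<bullet> g (?r t)"] gt
      by (simp add: gderiv_def)
    then have "((\<lambda>t. ?S \<theta>) has_derivative (\<lambda>s. (s *\<^sub>R \<theta>) \<bullet> g (?r t))) (at t)"
    proof (rule has_derivative_transform_within_open[where s = "{-1<..}"])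
      show "?S (?r x) = ?S \<theta>" if "x \<in> {-1<..}" for x
        using that S_obj_scaleR[of "1 + x"] by simp
    qed (use t in auto)
    then have "(\<lambda>s. (s *\<^sub>R \<theta>) \<bullet> g (?r t)) = (\<lambda>s. 0)"
      using has_derivative_unique has_derivative_const by blast
    from fun_cong[OF this, of 1] show ?thesis by simp
  qed
  have "(?r \<longlongrightarrow> ?r 0) (nhds 0)"
    by (intro tendsto_intros) (auto simp: filterlim_ident)
  then have "filterlim ?r (nhds \<theta>) (nhds 0)" by simp
  then have "\<forall>\<^sub>F t in nhds 0. GDERIV ?S (?r t) :> g (?r t)"
    using g unfolding filterlim_iff by blast
  moreover have "\<forall>\<^sub>F t in nhds 0. t > (-1::real)"
    using eventually_nhds_in_open[of "{-1<..}" "0::real"] by simp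
  ultimately have ev: "\<forall>\<^sub>F t in nhds 0. \<theta> \<bullet> g (?r t) = 0"
    by eventually_elim (rule zero)
  have "((\<lambda>t. g (?r t)) has_derivative (\<lambda>s. H *v (s *\<^sub>R \<theta>))) (at 0)"
    using has_derivative_compose[OF r[of 0], of g "\<lambda>h. H *v h"] g' by simp
  then have d: "((\<lambda>t. \<theta> \<bullet> g (?r t)) has_derivative (\<lambda>s. \<theta> \<bullet> (H *v (s *\<^sub>R \<theta>)))) (at 0)"
    by (rule has_derivative_inner_right)
  obtain U where U: "open U" "0 \<in> U" "\<And>t. t \<in> U \<Longrightarrow> \<theta> \<bullet> g (?r t) = 0"
    using ev by (auto simp: eventually_nhds)
  have "((\<lambda>t. 0) has_derivative (\<lambda>s. \<theta> \<bullet> (H *v (s *\<^sub>R \<theta>)))) (at (0::real))"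
    using has_derivative_transform_within_open[OF d U] by blast
  then have "(\<lambda>s. \<theta> \<bullet> (H *v (s *\<^sub>R \<theta>))) = (\<lambda>s. 0)"
    using has_derivative_unique has_derivative_const by blast
  from fun_cong[OF this, of 1] show ?thesis by simp
qed

text \<open>The solution set of the gradient-descent algorithm. Taken literally, the second-order
  condition \<open>\<nabla>\<^sup>2S(\<theta>) \<succ> 0\<close> holds at no point of \<open>Dset \<epsilon>l \<epsilon>u\<close> when \<open>\<epsilon>l > 0\<close>, by
  \<open>S_obj_hessian_ray\<close>. It is therefore required modulo the scaling of \<open>\<theta>\<close>: the Hessian is
  positive in every direction that is not a multiple of \<open>\<theta>\<close> (and vanishes along \<open>\<theta>\<close>).\<close>

definition I2 ::
  "('n::finite \<times> 'p::{finite,linorder}, 'z::finite) rmat \<Rightarrow> ('n \<times> 'p, 'n \<times> 'm::{finite,linorder}) rmat \<Rightarrow> 'z rvec \<Rightarrow> ('n \<times> 'm) rvec \<Rightarrow> real \<Rightarrow> real \<Rightarrow>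
   (('p, 'm) theta) set" where
  "I2 Kp Kf z ut \<epsilon>l \<epsilon>u = {\<theta> \<in> Dset \<epsilon>l \<epsilon>u.
     (ut - u_star Kp Kf z \<theta>) v*
       (matrix_inv (Hmat Kf (Q_of \<theta>) (R_of \<theta>)) ** Phi Kp Kf z (u_star Kp Kf z \<theta>)) = 0 \<and>
     GDERIV (S_obj Kp Kf z ut) \<theta> :> 0 \<and>
     (\<exists>H. has_hessian (S_obj Kp Kf z ut) H \<theta> \<and> transpose H = H \<and>
          (\<forall>v. v \<notin> span {\<theta>} \<longrightarrow> 0 < v \<bullet> (H *v v)))}"

end

theory Submission
  imports Defs
begin

text \<open>The solution \<open>\<theta>\<close> of the KKT-based problem leaves no residual. Its weights satisfy the
  stationarity equation at \<open>ut\<close>, and because they are bounded below by the identity the lower-level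
  cost is strictly convex, so \<open>ut\<close> is its unique minimizer (\<open>arg_min_cost_if_stat_eq_0\<close>). Hence
  \<open>S_obj\<close> vanishes at \<open>\<theta>\<close>, which is a global minimum, and both first-order conditions hold because
  each has the factor \<open>ut - u_star Kp Kf z \<theta> = 0\<close>.

  For the second-order condition, \<open>S_obj\<close> is a least-squares objective with zero residual, so its
  Hessian is exactly the Gauss--Newton matrix \<open>2 *\<^sub>R (transpose J ** J)\<close>, where \<open>J\<close> is the Jacobian
  of the residual (\<open>norm_sq_has_hessian\<close>). Implicit differentiation of the stationarity equation
  gives \<open>J = matrix_inv H ** Phi\<close> with the invertible matrix \<open>H\<close> of the lower-level problem
  (\<open>u_star_has_derivative\<close>). The Hessian is therefore positive in every direction outside the kernel
  of \<open>Phi\<close>, that is, in every direction along which \<open>ut\<close> ceases to be stationary.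

  Identifiability says that this kernel is the line through \<open>\<theta>\<close>: moving a little along a kernel
  direction keeps the weights positive definite and \<open>ut\<close> stationary, so it stays on the ray of the
  true weights (\<open>stat_kernel_in_span\<close>). These are the directions excluded in \<open>I2\<close>.\<close>

section \<open>Matrices bounded below\<close>

lemma mat_loewner_iff:
  "mat c \<preceq> M \<longleftrightarrow> transpose M = M \<and> (\<forall>x. c * (x \<bullet> x) \<le> x \<bullet> (M *v x))"
proof -
  have m: "(mat c :: real^'a^'a) = c *\<^sub>R mat 1"
    by (simp add: mat_def vec_eq_iff)
  have "transpose (M - mat c) = transpose M - mat c"
    by (simp add: transpose_def mat_def vec_eq_iff)
  moreover have "(mat c :: real^'a^'a) *v x = c *\<^sub>R x" for x
    by (simp add: m scaleR_matrix_vector_assoc [symmetric])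
  ultimately show ?thesis
    by (simp add: loewner_le_def possemidef_def matrix_vector_mult_diff_rdistrib inner_diff_right)
qed

lemma mat_loewner_mono: "mat c \<preceq> M \<Longrightarrow> d \<le> c \<Longrightarrow> mat d \<preceq> M"
  unfolding mat_loewner_iff by (meson inner_ge_zero mult_right_mono order_trans)

lemma posdef_if_mat_loewner: "mat c \<preceq> M \<Longrightarrow> 0 < c \<Longrightarrow> posdef M"
  unfolding mat_loewner_iff posdef_def
  by (meson inner_gt_zero_iff less_le_trans mult_pos_pos)

lemma norm_le_if_mat_loewner:
  assumes "mat c \<preceq> M"
  shows "c * norm x \<le> norm (M *v x)"
proof (cases "x = 0")
  case False
  have "c * norm x * norm x = c * (x \<bullet> x)"
    by (simp add: dot_square_norm power2_eq_square)
  also have "\<dots> \<le> x \<bullet> (M *v x)"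
    using assms by (simp add: mat_loewner_iff)
  also have "\<dots> \<le> norm (M *v x) * norm x"
    using norm_cauchy_schwarz[of x "M *v x"] by (simp add: mult.commute)
  finally show ?thesis
    using False by simp
qed simp

lemma matrix_inv_if_mat_loewner:
  assumes "mat c \<preceq> M" "0 < c"
  shows "M ** matrix_inv M = mat 1" and "matrix_inv M ** M = mat 1"
proof -
  have "x = 0" if "M *v x = 0" for x
    using norm_le_if_mat_loewner[OF assms(1), of x] that assms(2)
    by (simp add: mult_le_0_iff)
  then have "\<exists>B. B ** M = mat 1"
    by (simp add: matrix_left_invertible_ker)
  then have "\<exists>B. M ** B = mat 1 \<and> B ** M = mat 1"
    using matrix_left_right_inverse[of _ M] by blast
  then show "M ** matrix_inv M = mat 1" and "matrix_inv M ** M = mat 1"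
    unfolding matrix_inv_def by (metis (mono_tags, lifting) someI_ex)+
qed

lemma bounded_bilinear_linear_matrix:
  fixes M :: "'e::euclidean_space \<Rightarrow> ('a::finite, 'b::finite) rmat"
  assumes "linear M"
  shows "bounded_bilinear (\<lambda>y x. M y *v x)"
proof -
  have "bilinear (\<lambda>y x. M y *v x)"
    using assms unfolding bilinear_def
    by (auto intro!: linearI simp: linear_add linear_scale matrix_vector_mult_add_rdistrib
        scaleR_matrix_vector_assoc [symmetric])
  then show ?thesis
    by (simp add: bilinear_conv_bounded_bilinear)
qed

text \<open>On a finite-dimensional parameter space the quadratic form of \<open>M (y - a)\<close> at \<open>x\<close> is at most
  \<open>K * norm (y - a) * (x \<bullet> x)\<close> in absolute value, so a small step costs little of the bound.\<close>

lemma eventually_mat_loewner: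
  fixes M :: "'e::euclidean_space \<Rightarrow> ('a::finite, 'a) rmat"
  assumes lin: "linear M" and sym: "\<And>y. transpose (M y) = M y"
    and a: "mat c \<preceq> M a" and dc: "d < c"
  shows "\<forall>\<^sub>F y in nhds a. mat d \<preceq> M y"
proof -
  interpret B: bounded_bilinear "\<lambda>y x. M y *v x"
    by (rule bounded_bilinear_linear_matrix[OF lin])
  obtain K where K: "0 < K" "\<And>y x. norm (M y *v x) \<le> norm y * norm x * K"
    using B.pos_bounded by blast
  have "mat d \<preceq> M y" if y: "dist y a < (c - d) / K" for y
  proof -
    have "d * (x \<bullet> x) \<le> x \<bullet> (M y *v x)" for x
    proof -
      have "\<bar>x \<bullet> (M (y - a) *v x)\<bar> \<le> norm x * norm (M (y - a) *v x)"
        by (rule Cauchy_Schwarz_ineq2)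
      also have "\<dots> \<le> norm x * (norm (y - a) * norm x * K)"
        by (intro mult_left_mono K) simp
      also have "\<dots> = (norm (y - a) * K) * (x \<bullet> x)"
        by (simp add: dot_square_norm power2_eq_square)
      also have "\<dots> \<le> (c - d) * (x \<bullet> x)"
        using y K(1) by (intro mult_right_mono) (auto simp: dist_norm field_simps)
      finally have "- (x \<bullet> (M (y - a) *v x)) \<le> (c - d) * (x \<bullet> x)"
        by simp
      moreover have "c * (x \<bullet> x) \<le> x \<bullet> (M a *v x)"
        using a by (simp add: mat_loewner_iff)
      ultimately show ?thesis
        by (simp add: B.diff_left inner_diff_right algebra_simps)
    qed
    then show ?thesis
      using sym by (simp add: mat_loewner_iff)
  qed
  moreover have "0 < (c - d) / K"
    using dc K(1) by simp
  ultimately show ?thesis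
    unfolding eventually_nhds_metric by blast
qed

section \<open>Differentiating the solution of a linear system\<close>

text \<open>The derivative \<open>x'\<close> is found by differentiating \<open>M y *v x y = q y\<close> formally. Substituting
  gives \<open>M y *v (x y - x a - x' (y - a)) = (q y - q a - q' (y - a)) - M (y - a) *v x' (y - a)\<close>,
  whose right-hand side is \<open>o(norm (y - a))\<close>. Since \<open>M y\<close> stretches every vector by at least \<open>c\<close>,
  uniformly in \<open>y\<close>, so is the remainder of \<open>x\<close>.\<close>

lemma solution_has_derivative:
  fixes M :: "'e::euclidean_space \<Rightarrow> ('a::finite, 'a) rmat"
  assumes lin: "linear M" and c: "0 < c"
    and ev: "\<forall>\<^sub>F y in nhds a. mat c \<preceq> M y \<and> M y *v x y = q y"
    and q: "(q has_derivative q') (at a)"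
  shows "(x has_derivative (\<lambda>h. matrix_inv (M a) *v (q' h - M h *v x a))) (at a)"
    (is "(x has_derivative ?x') _")
proof -
  interpret B: bounded_bilinear "\<lambda>y x. M y *v x"
    by (rule bounded_bilinear_linear_matrix[OF lin])
  obtain K where K: "0 < K" "\<And>y x. norm (M y *v x) \<le> norm y * norm x * K"
    using B.pos_bounded by blast
  have at_a: "mat c \<preceq> M a" "M a *v x a = q a"
    using eventually_nhds_x_imp_x[OF ev] by auto
  have bl: "bounded_linear ?x'"
    by (intro bounded_linear_compose[OF matrix_vector_mul_bounded_linear] bounded_linear_sub
        has_derivative_bounded_linear[OF q] B.bounded_linear_left)
  then obtain L where L: "0 < L" "\<And>h. norm (?x' h) \<le> norm h * L"
    using bounded_linear.pos_bounded by blast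
  have x': "M a *v ?x' h = q' h - M h *v x a" for h
    by (simp add: matrix_vector_mul_assoc matrix_inv_if_mat_loewner(1)[OF at_a(1) c])
  obtain e where e: "0 < e"
    and near: "\<And>y. dist y a < e \<Longrightarrow> mat c \<preceq> M y \<and> M y *v x y = q y"
    using ev by (auto simp: eventually_nhds_metric)
  let ?rem = "\<lambda>y. norm (q y - q a - q' (y - a)) / norm (y - a)"
  let ?H = "\<lambda>y. (?rem y + L * K * norm (y - a)) / c"
  show ?thesis
  proof (rule has_derivativeI_sandwich[OF e bl])
    fix y assume ya: "y \<noteq> a" and y: "dist y a < e"
    let ?h = "y - a"
    have "M y *v (x y - x a - ?x' ?h)
        = q y - (q a + M ?h *v x a) - (M a *v ?x' ?h + M ?h *v ?x' ?h)"
      using near[OF y] at_a(2) by (simp add: B.diff_left B.diff_right)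
    then have eq: "M y *v (x y - x a - ?x' ?h) = (q y - q a - q' ?h) - M ?h *v ?x' ?h"
      unfolding x' by simp
    have "c * norm (x y - x a - ?x' ?h) \<le> norm ((q y - q a - q' ?h) - M ?h *v ?x' ?h)"
      using norm_le_if_mat_loewner[of c "M y" "x y - x a - ?x' ?h"] near[OF y] by (simp only: eq)
    also have "\<dots> \<le> norm (q y - q a - q' ?h) + norm (M ?h *v ?x' ?h)"
      by (rule norm_triangle_ineq4)
    also have "norm (M ?h *v ?x' ?h) \<le> norm ?h * norm (?x' ?h) * K"
      by (rule K)
    also have "\<dots> \<le> norm ?h * (norm ?h * L) * K"
      using K(1) by (intro mult_right_mono mult_left_mono L(2)) auto
    finally have le: "c * norm (x y - x a - ?x' ?h)
        \<le> norm (q y - q a - q' ?h) + norm ?h * (norm ?h * L) * K"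
      by simp
    have "norm (x y - x a - ?x' ?h)
        \<le> (norm (q y - q a - q' ?h) + norm ?h * (norm ?h * L) * K) / c"
      using le c by (simp add: pos_le_divide_eq mult.commute)
    then have "norm (x y - x a - ?x' ?h) / norm ?h
        \<le> (norm (q y - q a - q' ?h) + norm ?h * (norm ?h * L) * K) / c / norm ?h"
      by (rule divide_right_mono) simp
    also have "\<dots> = ?H y"
      using ya by (simp add: field_simps)
    finally show "norm (x y - x a - ?x' ?h) / norm ?h \<le> ?H y" .
  next
    have "(?rem \<longlongrightarrow> 0) (at a)"
      using q unfolding has_derivative_iff_norm by blast
    moreover have "((\<lambda>y. L * K * norm (y - a)) \<longlongrightarrow> L * K * norm (a - a)) (at a)"
      by (intro tendsto_intros)
    ultimately have "(?H \<longlongrightarrow> (0 + L * K * norm (a - a)) / c) (at a)"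
      using c by (intro tendsto_intros) auto
    then show "(?H \<longlongrightarrow> 0) (at a)"
      by simp
  qed
qed

lemma matrix_differentiable_if_columns:
  fixes J :: "'e::euclidean_space \<Rightarrow> ('a::finite, 'b::finite) rmat"
  assumes "\<And>j. (\<lambda>y. J y *v axis j 1) differentiable (at a)"
  shows "J differentiable (at a)"
proof -
  have "(\<lambda>y. J y \<bullet> i) differentiable (at a)" if i: "i \<in> Basis" for i :: "('a, 'b) rmat"
  proof -
    obtain k j where i: "i = axis k (axis j 1)"
      using i by (auto simp: Basis_vec_def)
    have "(\<lambda>y. (J y *v axis j 1) \<bullet> axis k 1) differentiable (at a)"
      using assms[of j] unfolding differentiable_componentwise_within[where f = "\<lambda>y. J y *v axis j 1"]
      by (simp add: Basis_vec_def)
    then show ?thesis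
      by (simp add: i inner_axis matrix_vector_mult_basis column_def)
  qed
  then show ?thesis
    unfolding differentiable_componentwise_within[where f = J] by blast
qed

section \<open>Least squares with zero residual\<close>

lemma norm_sq_has_gradient:
  fixes r :: "'a::finite rvec \<Rightarrow> 'b::finite rvec"
  assumes "(r has_derivative (\<lambda>h. J *v h)) (at y)"
  shows "GDERIV (\<lambda>y. (norm (r y))\<^sup>2) y :> 2 *\<^sub>R (r y v* J)"
proof -
  have "((\<lambda>y. r y \<bullet> r y) has_derivative (\<lambda>h. r y \<bullet> (J *v h) + (J *v h) \<bullet> r y)) (at y)"
    using assms assms by (rule has_derivative_inner)
  moreover have "r y \<bullet> (J *v h) + (J *v h) \<bullet> r y = h \<bullet> (2 *\<^sub>R (r y v* J))" for h
    by (simp add: dot_lmul_matrix inner_commute[of h] inner_commute[of _ "r y"])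
  ultimately show ?thesis
    by (simp add: gderiv_def power2_norm_eq_inner)
qed

text \<open>The gradient \<open>2 *\<^sub>R (r y v* J y)\<close> has two factors. Where \<open>r\<close> vanishes, the term that contains the
  derivative of \<open>J\<close> drops out of its derivative, and the Gauss--Newton matrix is the exact Hessian.\<close>

lemma norm_sq_has_hessian:
  fixes r :: "'a::finite rvec \<Rightarrow> 'b::finite rvec" and J :: "'a rvec \<Rightarrow> ('b, 'a) rmat"
  assumes r: "\<forall>\<^sub>F y in nhds x. (r has_derivative (\<lambda>h. J y *v h)) (at y)"
    and J: "J differentiable (at x)" and rx: "r x = 0"
  shows "has_hessian (\<lambda>y. (norm (r y))\<^sup>2) (2 *\<^sub>R (transpose (J x) ** J x)) x"
proof -
  have "bilinear (\<lambda>v (A :: ('b, 'a) rmat). v v* A)"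
    unfolding bilinear_def
    by (auto intro!: linearI simp: vector_matrix_left_distrib vector_matrix_mult_add_rdistrib
        scaleR_vector_matrix_assoc vector_scaleR_matrix_ac)
  then have bb: "bounded_bilinear (\<lambda>v (A :: ('b, 'a) rmat). v v* A)"
    by (simp add: bilinear_conv_bounded_bilinear)
  obtain J' where J': "(J has_derivative J') (at x)"
    using J by (auto simp: differentiable_def)
  have "((\<lambda>y. r y v* J y) has_derivative (\<lambda>h. r x v* J' h + (J x *v h) v* J x)) (at x)"
    by (rule bounded_bilinear.FDERIV[OF bb eventually_nhds_x_imp_x[OF r] J'])
  then have "((\<lambda>y. 2 *\<^sub>R (r y v* J y)) has_derivative
      (\<lambda>h. 2 *\<^sub>R (r x v* J' h + (J x *v h) v* J x))) (at x)"
    by (rule has_derivative_scaleR_right)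
  moreover have "2 *\<^sub>R (r x v* J' h + (J x *v h) v* J x) = 2 *\<^sub>R (transpose (J x) ** J x) *v h" for h
    by (simp add: rx scaleR_matrix_vector_assoc [symmetric] matrix_vector_mul_assoc [symmetric])
  ultimately have d: "((\<lambda>y. 2 *\<^sub>R (r y v* J y)) has_derivative
      (\<lambda>h. 2 *\<^sub>R (transpose (J x) ** J x) *v h)) (at x)"
    by simp
  have "\<forall>\<^sub>F y in nhds x. GDERIV (\<lambda>y. (norm (r y))\<^sup>2) y :> 2 *\<^sub>R (r y v* J y)"
    using r by eventually_elim (rule norm_sq_has_gradient)
  with d show ?thesis
    unfolding has_hessian_def by (intro exI[of _ "\<lambda>y. 2 *\<^sub>R (r y v* J y)"]) simp
qed

section \<open>The lower-level problem\<close>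

lemma inner_blkdiag:
  fixes x :: "('n::finite \<times> 'a::finite) rvec"
  shows "x \<bullet> (blkdiag Q *v x) = (\<Sum>k\<in>UNIV. (\<chi> i. x $ (k, i)) \<bullet> (Q *v (\<chi> i. x $ (k, i))))"
proof -
  have "(blkdiag Q *v x) $ (k, i) = (Q *v (\<chi> j. x $ (k, j))) $ i" for k i
  proof -
    have "(blkdiag Q *v x) $ (k, i)
        = (\<Sum>l\<in>UNIV. \<Sum>j\<in>UNIV. (if k = l then Q $ i $ j else 0) * x $ (l, j))"
      unfolding sum.cartesian_product
      by (simp add: matrix_vector_mult_def blkdiag_def case_prod_unfold cong: if_cong)
    also have "\<dots> = (\<Sum>l\<in>UNIV. if k = l then \<Sum>j\<in>UNIV. Q $ i $ j * x $ (l, j) else 0)"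
      by (intro sum.cong) auto
    finally show ?thesis
      by (simp add: matrix_vector_mult_def)
  qed
  then have "x \<bullet> (blkdiag Q *v x)
      = (\<Sum>(k, i)\<in>UNIV \<times> UNIV. x $ (k, i) * (Q *v (\<chi> j. x $ (k, j))) $ i)"
    unfolding inner_vec_def by (auto intro!: sum.cong)
  then show ?thesis
    by (simp add: inner_vec_def sum.cartesian_product)
qed

lemma transpose_blkdiag: "transpose Q = Q \<Longrightarrow> transpose (blkdiag Q) = blkdiag Q"
  by (auto simp: transpose_def blkdiag_def vec_eq_iff)

lemma mat_loewner_blkdiag:
  assumes "mat c \<preceq> Q"
  shows "mat c \<preceq> (blkdiag Q :: ('n::finite \<times> 'a::finite, 'n \<times> 'a) rmat)"
proof -
  have "c * (x \<bullet> x) \<le> x \<bullet> (blkdiag Q *v x)" for x :: "('n \<times> 'a) rvec"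
  proof -
    have "x \<bullet> x = (\<Sum>(k, i)\<in>UNIV \<times> UNIV. x $ (k, i) * x $ (k, i))"
      by (simp add: inner_vec_def case_prod_unfold)
    then have "c * (x \<bullet> x) = (\<Sum>k\<in>UNIV. c * ((\<chi> i. x $ (k, i)) \<bullet> (\<chi> i. x $ (k, i))))"
      by (simp add: inner_vec_def sum.cartesian_product sum_distrib_left)
    also have "\<dots> \<le> x \<bullet> (blkdiag Q *v x)"
      unfolding inner_blkdiag using assms by (intro sum_mono) (simp add: mat_loewner_iff)
    finally show ?thesis .
  qed
  then show ?thesis
    using assms by (simp add: mat_loewner_iff transpose_blkdiag)
qed

lemma mat_loewner_Hmat:
  assumes Q: "mat c \<preceq> Q" and R: "mat c \<preceq> R" and c: "0 \<le> c"
  shows "mat c \<preceq> Hmat Kf Q R"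
proof -
  have bQ: "mat c \<preceq> (blkdiag Q :: ('c \<times> 'a, 'c \<times> 'a) rmat)"
    and bR: "mat c \<preceq> (blkdiag R :: ('c \<times> 'b, 'c \<times> 'b) rmat)"
    using Q R by (auto intro: mat_loewner_blkdiag)
  have "transpose (Hmat Kf Q R) = Hmat Kf Q R"
    using bQ bR by (simp add: Hmat_def mat_loewner_iff transpose_add' matrix_transpose_mul
        matrix_mul_assoc del: transpose_matrix_vector)
  moreover have "c * (x \<bullet> x) \<le> x \<bullet> (Hmat Kf Q R *v x)" for x
  proof -
    have "x \<bullet> (Hmat Kf Q R *v x) = (Kf *v x) \<bullet> (blkdiag Q *v (Kf *v x)) + x \<bullet> (blkdiag R *v x)"
      by (simp add: Hmat_def matrix_vector_mult_add_rdistrib inner_add_right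
          matrix_vector_mul_assoc [symmetric] inner_commute[of x] dot_lmul_matrix)
        (simp add: inner_commute)
    moreover have "0 \<le> c * ((Kf *v x) \<bullet> (Kf *v x))"
      using c by simp
    ultimately show ?thesis
      using bQ bR unfolding mat_loewner_iff by (smt (verit))
  qed
  ultimately show ?thesis
    by (simp add: mat_loewner_iff)
qed

text \<open>The Taylor expansion of a quadratic function: \<open>stat\<close> is half the gradient of the cost, and
  \<open>Hmat\<close> half its Hessian.\<close>

lemma cost_expand:
  assumes Q: "transpose Q = Q" and R: "transpose R = R"
  shows "cost Kp Kf z Q R (u + d)
    = cost Kp Kf z Q R u + 2 * (d \<bullet> stat Kp Kf z Q R u) + d \<bullet> (Hmat Kf Q R *v d)"
proof -
  have H: "transpose (Hmat Kf Q R) = Hmat Kf Q R"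
    by (simp add: Hmat_def transpose_add' matrix_transpose_mul matrix_mul_assoc
        transpose_blkdiag Q R)
  have "d \<bullet> ((transpose Kf ** blkdiag Q ** Kp) *v z)
      = (transpose (transpose Kp ** blkdiag Q ** Kf) *v z) \<bullet> d"
    by (simp add: matrix_transpose_mul matrix_mul_assoc transpose_blkdiag Q inner_commute
        del: transpose_matrix_vector)
  then have "d \<bullet> ((transpose Kf ** blkdiag Q ** Kp) *v z)
      = z \<bullet> ((transpose Kp ** blkdiag Q ** Kf) *v d)"
    by (simp only: transpose_matrix_vector dot_lmul_matrix)
  moreover have "u \<bullet> (Hmat Kf Q R *v d) = d \<bullet> (Hmat Kf Q R *v u)"
    by (metis H dot_lmul_matrix inner_commute transpose_matrix_vector)
  ultimately show ?thesis
    by (simp add: cost_def stat_def transpose_blkdiag[OF Q] matrix_vector_right_distrib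
        inner_add_left inner_add_right algebra_simps)
qed

lemma arg_min_cost_if_stat_eq_0:
  assumes Q: "mat c \<preceq> Q" and R: "mat c \<preceq> R" and c: "0 < c"
    and u: "stat Kp Kf z Q R u = 0"
  shows "(ARG_MIN (cost Kp Kf z Q R) u. True) = u"
proof -
  have H: "posdef (Hmat Kf Q R)"
    using mat_loewner_Hmat[OF Q R] c by (auto intro: posdef_if_mat_loewner)
  have lt: "cost Kp Kf z Q R u < cost Kp Kf z Q R v" if "v \<noteq> u" for v
  proof -
    have "cost Kp Kf z Q R v = cost Kp Kf z Q R u + (v - u) \<bullet> (Hmat Kf Q R *v (v - u))"
      using cost_expand[of Q R Kp Kf z u "v - u"] Q R u by (simp add: mat_loewner_iff)
    moreover have "0 < (v - u) \<bullet> (Hmat Kf Q R *v (v - u))"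
      using H that by (simp add: posdef_def)
    ultimately show ?thesis
      by simp
  qed
  then have "is_arg_min (cost Kp Kf z Q R) (\<lambda>u. True) v \<longleftrightarrow> v = u" for v
    unfolding is_arg_min_def by (metis less_asym less_irrefl)
  then show ?thesis
    by (simp add: arg_min_def)
qed

text \<open>Invertibility of \<open>Hmat\<close> provides a stationary point, and by strict convexity this point is
  the minimizer that \<open>ARG_MIN\<close> selects.\<close>

lemma stat_u_star:
  assumes Q: "mat c \<preceq> Q_of \<theta>" and R: "mat c \<preceq> R_of \<theta>" and c: "0 < c"
  shows "stat Kp Kf z (Q_of \<theta>) (R_of \<theta>) (u_star Kp Kf z \<theta>) = 0"
proof -
  let ?H = "Hmat Kf (Q_of \<theta>) (R_of \<theta>)"
  let ?b = "(transpose Kf ** transpose (blkdiag (Q_of \<theta>)) ** Kp) *v z"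
  let ?u = "- (matrix_inv ?H *v ?b)"
  have "?H ** matrix_inv ?H = mat 1"
    using mat_loewner_Hmat[OF Q R] c by (auto intro: matrix_inv_if_mat_loewner(1))
  then have "?H *v (matrix_inv ?H *v ?b) = ?b"
    using matrix_vector_mul_assoc[of ?H "matrix_inv ?H" ?b] by (simp only: matrix_vector_mul_lid)
  then have u: "stat Kp Kf z (Q_of \<theta>) (R_of \<theta>) ?u = 0"
    unfolding stat_def linear_neg[OF matrix_vector_mul_linear] by simp
  have "u_star Kp Kf z \<theta> = ?u"
    unfolding u_star_def by (rule arg_min_cost_if_stat_eq_0[OF Q R c u])
  then show ?thesis
    using u by (simp only:)
qed

section \<open>Sensitivity of the lower-level solution\<close>

lemma linear_stat: "linear (\<lambda>\<theta>. stat Kp Kf z (Q_of \<theta>) (R_of \<theta>) u)"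
  by (rule linearI) (simp_all add: Q_of_add R_of_add Q_of_scaleR R_of_scaleR stat_add stat_scaleR)

lemma Phi_works: "Phi Kp Kf z u *v \<theta> = stat Kp Kf z (Q_of \<theta>) (R_of \<theta>) u"
  by (simp add: Phi_def matrix_works linear_stat)

lemma linear_Hmat: "linear (\<lambda>\<theta>. Hmat Kf (Q_of \<theta>) (R_of \<theta>))"
  by (rule linearI)
    (simp_all add: Hmat_def Q_of_add R_of_add Q_of_scaleR R_of_scaleR blkdiag_add blkdiag_scaleR
      matrix_add_ldistrib matrix_add_rdistrib' matrix_mul_scaleR_left matrix_mul_scaleR_right
      scaleR_add_right)

lemma transpose_Q_of: "transpose (Q_of \<theta>) = Q_of \<theta>"
  and transpose_R_of: "transpose (R_of \<theta>) = R_of \<theta>"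
  by (simp_all add: Q_of_def R_of_def transpose_unvech)

lemma eventually_weights_mat_loewner:
  fixes \<theta> :: "('p::{finite,linorder}, 'm::{finite,linorder}) theta"
  assumes "mat c \<preceq> Q_of \<theta>" "mat c \<preceq> R_of \<theta>" "d < c"
  shows "\<forall>\<^sub>F y in nhds \<theta>. mat d \<preceq> Q_of y \<and> mat d \<preceq> R_of y"
proof (rule eventually_conj)
  show "\<forall>\<^sub>F y in nhds \<theta>. mat d \<preceq> Q_of y"
    by (rule eventually_mat_loewner[where M = Q_of, OF _ _ assms(1,3)])
      (auto intro: linearI simp: Q_of_add Q_of_scaleR transpose_Q_of)
  show "\<forall>\<^sub>F y in nhds \<theta>. mat d \<preceq> R_of y"
    by (rule eventually_mat_loewner[where M = R_of, OF _ _ assms(2,3)])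
      (auto intro: linearI simp: R_of_add R_of_scaleR transpose_R_of)
qed

text \<open>For positive definite weights this is the negative Jacobian of \<open>u_star Kp Kf z\<close>, and thus the
  Jacobian of the residual \<open>ut - u_star Kp Kf z \<theta>\<close>.\<close>

abbreviation sensitivity where
  "sensitivity Kp Kf z \<theta> \<equiv>
     matrix_inv (Hmat Kf (Q_of \<theta>) (R_of \<theta>)) ** Phi Kp Kf z (u_star Kp Kf z \<theta>)"

text \<open>Differentiating the stationarity equation \<open>stat Kp Kf z (Q_of \<theta>) (R_of \<theta>) u = 0\<close>, which is
  linear in \<open>\<theta>\<close> and affine in \<open>u\<close>, along its solution.\<close>

lemma u_star_has_derivative:
  fixes \<theta> :: "('p::{finite,linorder}, 'm::{finite,linorder}) theta"
  assumes Q: "mat c \<preceq> Q_of \<theta>" and R: "mat c \<preceq> R_of \<theta>" and c: "0 < c"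
  shows "(u_star Kp Kf z has_derivative (\<lambda>h. - (sensitivity Kp Kf z \<theta> *v h))) (at \<theta>)"
proof -
  let ?M = "\<lambda>\<theta> :: ('p, 'm) theta. Hmat Kf (Q_of \<theta>) (R_of \<theta>)"
  let ?b = "\<lambda>\<theta> :: ('p, 'm) theta. stat Kp Kf z (Q_of \<theta>) (R_of \<theta>) 0"
  have stat: "stat Kp Kf z (Q_of y) (R_of y) u = ?M y *v u + ?b y" for y :: "('p, 'm) theta" and u
    by (simp add: stat_def)
  have "\<forall>\<^sub>F y in nhds \<theta>. mat (c/2) \<preceq> Q_of y \<and> mat (c/2) \<preceq> R_of y"
    using c by (intro eventually_weights_mat_loewner[OF Q R]) simp
  then have ev: "\<forall>\<^sub>F y in nhds \<theta>. mat (c/2) \<preceq> ?M y \<and> ?M y *v u_star Kp Kf z y = - ?b y"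
  proof eventually_elim
    case (elim y)
    then have Qy: "mat (c/2) \<preceq> Q_of y" and Ry: "mat (c/2) \<preceq> R_of y"
      by auto
    have "mat (c/2) \<preceq> ?M y"
      using c by (intro mat_loewner_Hmat[OF Qy Ry]) simp
    moreover have "?M y *v u_star Kp Kf z y + ?b y = 0"
      unfolding stat[symmetric] using c by (intro stat_u_star[OF Qy Ry]) simp
    ultimately show ?case
      by (simp add: eq_neg_iff_add_eq_0)
  qed
  have "(?b has_derivative ?b) (at \<theta>)"
    using linear_stat by (rule linear_imp_has_derivative)
  then have "((\<lambda>y. - ?b y) has_derivative (\<lambda>h. - ?b h)) (at \<theta>)"
    by (rule has_derivative_minus)
  from solution_has_derivative[OF linear_Hmat _ ev this]
  have "(u_star Kp Kf z has_derivative
      (\<lambda>h. matrix_inv (?M \<theta>) *v (- ?b h - ?M h *v u_star Kp Kf z \<theta>))) (at \<theta>)"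
    using c by simp
  moreover have "matrix_inv (?M \<theta>) *v (- ?b h - ?M h *v u_star Kp Kf z \<theta>)
      = - (sensitivity Kp Kf z \<theta> *v h)" for h
  proof -
    have "- ?b h - ?M h *v u_star Kp Kf z \<theta> = - (Phi Kp Kf z (u_star Kp Kf z \<theta>) *v h)"
      by (simp add: Phi_works stat[of h "u_star Kp Kf z \<theta>"])
    then show ?thesis
      by (simp only: linear_neg[OF matrix_vector_mul_linear] matrix_vector_mul_assoc)
  qed
  ultimately show ?thesis
    by simp
qed

text \<open>A column \<open>sensitivity Kp Kf z y *v axis j 1\<close> solves a system with the matrix of the
  stationarity equation and with a right-hand side that is affine in \<open>u_star Kp Kf z y\<close>, so that
  the solution of a linear system can be differentiated once more.\<close>

lemma sensitivity_differentiable: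
  fixes \<theta> :: "('p::{finite,linorder}, 'm::{finite,linorder}) theta"
  assumes Q: "mat c \<preceq> Q_of \<theta>" and R: "mat c \<preceq> R_of \<theta>" and c: "0 < c"
  shows "sensitivity Kp Kf z differentiable (at \<theta>)"
proof (rule matrix_differentiable_if_columns)
  fix j :: "'p tri + 'm tri"
  let ?M = "\<lambda>\<theta> :: ('p, 'm) theta. Hmat Kf (Q_of \<theta>) (R_of \<theta>)"
  let ?e = "axis j 1 :: ('p, 'm) theta"
  let ?q = "\<lambda>y. Phi Kp Kf z (u_star Kp Kf z y) *v ?e"
  have "\<forall>\<^sub>F y in nhds \<theta>. mat (c/2) \<preceq> Q_of y \<and> mat (c/2) \<preceq> R_of y"
    using c by (intro eventually_weights_mat_loewner[OF Q R]) simp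
  then have ev: "\<forall>\<^sub>F y in nhds \<theta>. mat (c/2) \<preceq> ?M y \<and> ?M y *v (sensitivity Kp Kf z y *v ?e) = ?q y"
  proof eventually_elim
    case (elim y)
    then have "mat (c/2) \<preceq> ?M y"
      using c by (intro mat_loewner_Hmat) auto
    then show ?case
      using c by (simp add: matrix_vector_mul_assoc matrix_mul_assoc matrix_inv_if_mat_loewner(1))
  qed
  have q: "?q = (\<lambda>y. ?M ?e *v u_star Kp Kf z y + stat Kp Kf z (Q_of ?e) (R_of ?e) 0)"
    unfolding Phi_works by (simp add: stat_def fun_eq_iff)
  have "(?q has_derivative (\<lambda>h. ?M ?e *v - (sensitivity Kp Kf z \<theta> *v h))) (at \<theta>)"
    unfolding q
    by (intro has_derivative_add_const
        bounded_linear.has_derivative[OF matrix_vector_mul_bounded_linear]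
        u_star_has_derivative[OF Q R c])
  from solution_has_derivative[OF linear_Hmat _ ev this]
  show "(\<lambda>y. sensitivity Kp Kf z y *v ?e) differentiable (at \<theta>)"
    using c unfolding differentiable_def by auto
qed

text \<open>The residual \<open>ut - u_star Kp Kf z y\<close> vanishes at \<open>\<theta>\<close> and has the Jacobian
  \<open>sensitivity Kp Kf z y\<close>. At \<open>\<theta>\<close> the kernel of this Jacobian is that of \<open>Phi Kp Kf z ut\<close>, because
  the inverse in front is injective; outside it the Gauss--Newton Hessian is positive.\<close>

lemma S_obj_zero_residual:
  fixes \<theta> :: "('p::{finite,linorder}, 'm::{finite,linorder}) theta"
  assumes Q: "mat c \<preceq> Q_of \<theta>" and R: "mat c \<preceq> R_of \<theta>" and c: "0 < c"
    and stat: "stat Kp Kf z (Q_of \<theta>) (R_of \<theta>) ut = 0"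
  shows "u_star Kp Kf z \<theta> = ut"
    and "GDERIV (S_obj Kp Kf z ut) \<theta> :> 0"
    and "\<exists>H. has_hessian (S_obj Kp Kf z ut) H \<theta> \<and> transpose H = H \<and>
      (\<forall>v. stat Kp Kf z (Q_of v) (R_of v) ut \<noteq> 0 \<longrightarrow> 0 < v \<bullet> (H *v v))"
proof -
  let ?J = "sensitivity Kp Kf z"
  show u: "u_star Kp Kf z \<theta> = ut"
    using arg_min_cost_if_stat_eq_0[OF Q R c stat] by (simp add: u_star_def)
  have S: "S_obj Kp Kf z ut = (\<lambda>y. (norm (ut - u_star Kp Kf z y))\<^sup>2)"
    by (simp add: S_obj_def fun_eq_iff)
  have r: "((\<lambda>y. ut - u_star Kp Kf z y) has_derivative (\<lambda>h. ?J y *v h)) (at y)"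
    if "mat (c/2) \<preceq> Q_of y" "mat (c/2) \<preceq> R_of y" for y
    using has_derivative_diff[OF has_derivative_const[of ut] u_star_has_derivative[OF that]] c
    by simp
  have "GDERIV (\<lambda>y. (norm (ut - u_star Kp Kf z y))\<^sup>2) \<theta> :> 2 *\<^sub>R ((ut - u_star Kp Kf z \<theta>) v* ?J \<theta>)"
    using c by (intro norm_sq_has_gradient r mat_loewner_mono[OF Q] mat_loewner_mono[OF R]) auto
  then show "GDERIV (S_obj Kp Kf z ut) \<theta> :> 0"
    by (simp add: S u)
  let ?H = "2 *\<^sub>R (transpose (?J \<theta>) ** ?J \<theta>)"
  have "\<forall>\<^sub>F y in nhds \<theta>. mat (c/2) \<preceq> Q_of y \<and> mat (c/2) \<preceq> R_of y"
    using c by (intro eventually_weights_mat_loewner[OF Q R]) simp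
  then have "\<forall>\<^sub>F y in nhds \<theta>.
      ((\<lambda>y. ut - u_star Kp Kf z y) has_derivative (\<lambda>h. ?J y *v h)) (at y)"
    by eventually_elim (blast intro: r)
  then have "has_hessian (S_obj Kp Kf z ut) ?H \<theta>"
    unfolding S by (rule norm_sq_has_hessian[OF _ sensitivity_differentiable[OF Q R c]]) (simp add: u)
  moreover have "transpose ?H = ?H"
    by (simp add: transpose_scaleR' matrix_transpose_mul)
  moreover have "0 < v \<bullet> (?H *v v)" if v: "stat Kp Kf z (Q_of v) (R_of v) ut \<noteq> 0" for v
  proof -
    have "Hmat Kf (Q_of \<theta>) (R_of \<theta>) *v (?J \<theta> *v v) = stat Kp Kf z (Q_of v) (R_of v) ut"
      by (simp add: matrix_vector_mul_assoc matrix_mul_assoc u Phi_works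
          matrix_inv_if_mat_loewner(1)[OF mat_loewner_Hmat[OF Q R] c] c less_imp_le)
    then have "?J \<theta> *v v \<noteq> 0"
      using v by auto
    moreover have "v \<bullet> (?H *v v) = 2 * ((?J \<theta> *v v) \<bullet> (?J \<theta> *v v))"
      by (simp add: scaleR_matrix_vector_assoc [symmetric] matrix_vector_mul_assoc [symmetric]
          inner_commute[of v] dot_lmul_matrix)
    ultimately show ?thesis
      by simp
  qed
  ultimately show "\<exists>H. has_hessian (S_obj Kp Kf z ut) H \<theta> \<and> transpose H = H \<and>
      (\<forall>v. stat Kp Kf z (Q_of v) (R_of v) ut \<noteq> 0 \<longrightarrow> 0 < v \<bullet> (H *v v))"
    by blast
qed

section \<open>Identifiability and the KKT-based problem\<close>

text \<open>For small \<open>t\<close> the weights encoded by \<open>\<theta> + t *\<^sub>R v\<close> are still positive definite and still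
  solve the stationarity equation. Identifiability places both \<open>\<theta>\<close> and \<open>\<theta> + t *\<^sub>R v\<close> on the ray of the
  true weights, and hence their difference quotient \<open>v\<close> on its line.\<close>

lemma stat_kernel_in_span:
  fixes \<theta> v :: "('p::{finite,linorder}, 'm::{finite,linorder}) theta"
  assumes ident: "identifiable Kp Kf z ut Q\<^sub>0 R\<^sub>0"
    and Q: "mat c \<preceq> Q_of \<theta>" and R: "mat c \<preceq> R_of \<theta>" and c: "0 < c"
    and stat: "stat Kp Kf z (Q_of \<theta>) (R_of \<theta>) ut = 0"
    and v: "stat Kp Kf z (Q_of v) (R_of v) ut = 0"
  shows "v \<in> span {\<theta>}"
proof -
  have ray: "\<exists>a>0. Q_of y = a *\<^sub>R Q\<^sub>0 \<and> R_of y = a *\<^sub>R R\<^sub>0"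
    if "mat (c/2) \<preceq> Q_of y" "mat (c/2) \<preceq> R_of y" "stat Kp Kf z (Q_of y) (R_of y) ut = 0"
    for y :: "('p, 'm) theta"
    using that c posdef_if_mat_loewner[OF that(1)] posdef_if_mat_loewner[OF that(2)]
      ident[unfolded identifiable_def, rule_format, of "Q_of y" "R_of y"] by simp
  obtain a where a: "0 < a" "Q_of \<theta> = a *\<^sub>R Q\<^sub>0" "R_of \<theta> = a *\<^sub>R R\<^sub>0"
    using ray[OF mat_loewner_mono[OF Q] mat_loewner_mono[OF R] stat] c by auto
  have "((\<lambda>t. \<theta> + t *\<^sub>R v) \<longlongrightarrow> \<theta> + 0 *\<^sub>R v) (at (0::real))"
    by (intro tendsto_intros)
  then have "filterlim (\<lambda>t. \<theta> + t *\<^sub>R v) (nhds \<theta>) (at (0::real))"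
    by simp
  moreover have "\<forall>\<^sub>F y in nhds \<theta>. mat (c/2) \<preceq> Q_of y \<and> mat (c/2) \<preceq> R_of y"
    using c by (intro eventually_weights_mat_loewner[OF Q R]) simp
  ultimately have "\<forall>\<^sub>F t in at (0::real).
      mat (c/2) \<preceq> Q_of (\<theta> + t *\<^sub>R v) \<and> mat (c/2) \<preceq> R_of (\<theta> + t *\<^sub>R v)"
    unfolding filterlim_iff by blast
  moreover have "\<forall>\<^sub>F t in at (0::real). t \<noteq> 0"
    by (simp add: eventually_at_filter)
  ultimately have "\<forall>\<^sub>F t in at (0::real). t \<noteq> 0 \<and>
      mat (c/2) \<preceq> Q_of (\<theta> + t *\<^sub>R v) \<and> mat (c/2) \<preceq> R_of (\<theta> + t *\<^sub>R v)"
    by eventually_elim simp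
  then obtain t :: real where t: "t \<noteq> 0"
    "mat (c/2) \<preceq> Q_of (\<theta> + t *\<^sub>R v)" "mat (c/2) \<preceq> R_of (\<theta> + t *\<^sub>R v)"
    using eventually_happens'[OF at_neq_bot] by blast
  have "stat Kp Kf z (Q_of (\<theta> + t *\<^sub>R v)) (R_of (\<theta> + t *\<^sub>R v)) ut = 0"
    by (simp add: Q_of_add R_of_add Q_of_scaleR R_of_scaleR stat_add stat_scaleR stat v)
  then obtain b where b: "Q_of (\<theta> + t *\<^sub>R v) = b *\<^sub>R Q\<^sub>0" "R_of (\<theta> + t *\<^sub>R v) = b *\<^sub>R R\<^sub>0"
    using ray[OF t(2,3)] by blast
  have eq: "y = y'" if "Q_of y = Q_of y'" "R_of y = R_of y'" for y y' :: "('p, 'm) theta"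
  proof -
    have "(\<chi> k. y $ Inl k) = (\<chi> k. y' $ Inl k)" "(\<chi> k. y $ Inr k) = (\<chi> k. y' $ Inr k)"
      using that vech_unvech unfolding Q_of_def R_of_def by metis+
    then have "y $ i = y' $ i" for i
      by (cases i) (simp_all add: vec_eq_iff)
    then show ?thesis
      by (simp add: vec_eq_iff)
  qed
  have "\<theta> + t *\<^sub>R v = (b / a) *\<^sub>R \<theta>"
    using a b by (intro eq) (simp_all add: Q_of_scaleR R_of_scaleR)
  then have "t *\<^sub>R v = (b / a - 1) *\<^sub>R \<theta>"
    by (simp add: algebra_simps)
  then have "inverse t *\<^sub>R (t *\<^sub>R v) = inverse t *\<^sub>R ((b / a - 1) *\<^sub>R \<theta>)"
    by simp
  then have "v = (inverse t * (b / a - 1)) *\<^sub>R \<theta>"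
    using t(1) by simp
  then show ?thesis
    by (metis span_base span_scale singletonI)
qed

lemma mat_loewner_diag2D:
  assumes "mat c \<preceq> diag2 Q R" "transpose Q = Q" "transpose R = R"
  shows "mat c \<preceq> Q" and "mat c \<preceq> R"
proof -
  have form: "col x y \<bullet> (diag2 Q R *v col x y) = x \<bullet> (Q *v x) + y \<bullet> (R *v y)"
    and norm: "col x y \<bullet> col x y = x \<bullet> x + y \<bullet> y" for x y
    by (simp_all add: diag2_def row_blocks_def col_def inner_vec_def matrix_vector_mult_def
        UNIV_Plus_UNIV[symmetric] sum.Plus del: UNIV_Plus_UNIV)
  have "c * (x \<bullet> x + y \<bullet> y) \<le> x \<bullet> (Q *v x) + y \<bullet> (R *v y)" for x y
    using assms(1) unfolding mat_loewner_iff form[symmetric] norm[symmetric] by blast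
  from this[of _ 0] this[of 0 _] show "mat c \<preceq> Q" and "mat c \<preceq> R"
    using assms(2,3) by (simp_all add: mat_loewner_iff)
qed

theorem proposition4:
  fixes A :: "('s::finite, 's) rmat" and B :: "('s, 'm::{finite,linorder}) rmat"
    and C :: "('p::{finite,linorder}, 's) rmat" and D :: "('p, 'm) rmat"
    and ud uo :: "nat \<Rightarrow> 'm rvec" and yd yo :: "nat \<Rightarrow> 'p rvec"
    and Up :: "('t::{finite,linorder} \<times> 'm, 'l::{finite,linorder}) rmat"
    and Yp :: "('t \<times> 'p, 'l) rmat"
    and Uf :: "('n::{finite,linorder} \<times> 'm, 'l) rmat"
    and Yf :: "('n \<times> 'p, 'l) rmat"
    and Kp :: "('n \<times> 'p, ('t \<times> 'm) + ('t \<times> 'p)) rmat"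
    and Kf :: "('n \<times> 'p, 'n \<times> 'm) rmat"
    and z_ini :: "(('t \<times> 'm) + ('t \<times> 'p)) rvec"
    and ut :: "('n \<times> 'm) rvec"
    and Q\<^sub>0 Q\<^sub>1 :: "('p, 'p) rmat" and R\<^sub>0 R\<^sub>1 :: "('m, 'm) rmat"
    and \<epsilon>l \<epsilon>u \<kappa> :: real
  assumes offline: "lti_trajectory A B C D (CARD('t) + CARD('n) + CARD('l) - 1) ud yd"
    and Up: "Up = hankel 0 ud" and Uf: "Uf = hankel CARD('t) ud"
    and Yp: "Yp = hankel 0 yd" and Yf: "Yf = hankel CARD('t) yd"
    and K: "row_blocks Kp Kf = Yf ** pinv (col (col Up Yp) Uf)"
    and observed: "lti_trajectory A B C D (CARD('t) + CARD('n)) uo yo"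
    and z_ini: "z_ini = col (stack 0 uo) (stack 0 yo)"
    and ut: "ut = stack CARD('t) uo"
    and weights: "posdef Q\<^sub>0" "posdef R\<^sub>0"
    and noiseless: "is_arg_min (cost Kp Kf z_ini Q\<^sub>0 R\<^sub>0) (\<lambda>u. True) ut"
    and ident: "identifiable Kp Kf z_ini ut Q\<^sub>0 R\<^sub>0"
    and eps: "0 < \<epsilon>l" "\<epsilon>l < \<epsilon>u" "\<epsilon>l \<le> 1"
    and kkt: "kkt_solution Kp Kf z_ini ut Q\<^sub>1 R\<^sub>1 \<kappa>"
    and upper: "Q\<^sub>1 \<preceq> mat \<epsilon>u" "R\<^sub>1 \<preceq> mat \<epsilon>u"
  shows "col (vech Q\<^sub>1) (vech R\<^sub>1) \<in> I2 Kp Kf z_ini ut \<epsilon>l \<epsilon>u"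
proof -
  let ?\<theta> = "col (vech Q\<^sub>1) (vech R\<^sub>1)"
  have sym: "transpose Q\<^sub>1 = Q\<^sub>1" "transpose R\<^sub>1 = R\<^sub>1"
    and stat: "stat Kp Kf z_ini Q\<^sub>1 R\<^sub>1 ut = 0" and lower: "mat 1 \<preceq> diag2 Q\<^sub>1 R\<^sub>1"
    using kkt by (auto simp: kkt_solution_def kkt_feasible_def)
  have of\<theta>: "Q_of ?\<theta> = Q\<^sub>1" "R_of ?\<theta> = R\<^sub>1"
    using sym by (simp_all add: Q_of_col R_of_col)
  have Q: "mat 1 \<preceq> Q_of ?\<theta>" and R: "mat 1 \<preceq> R_of ?\<theta>"
    using mat_loewner_diag2D[OF lower sym] by (simp_all add: of\<theta>)
  have stat\<theta>: "stat Kp Kf z_ini (Q_of ?\<theta>) (R_of ?\<theta>) ut = 0"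
    using stat by (simp add: of\<theta>)
  note zero = S_obj_zero_residual[OF Q R zero_less_one stat\<theta>]
  have "?\<theta> \<in> Dset \<epsilon>l \<epsilon>u"
    using mat_loewner_mono[OF Q eps(3)] mat_loewner_mono[OF R eps(3)] upper
    by (simp add: Dset_def of\<theta>)
  moreover have "stat Kp Kf z_ini (Q_of v) (R_of v) ut \<noteq> 0" if "v \<notin> span {?\<theta>}" for v
    using stat_kernel_in_span[OF ident Q R zero_less_one stat\<theta>] that by blast
  ultimately show ?thesis
    using zero by (auto simp: I2_def)
qed

end
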